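(* Let $$p(r)=4864r^4-824r^3-18804r^2-7850r+1 ,$$ and let $r_{\mathrm{tilt}}$ be the unique root of $p$ in the interval $(0.000127,0.000128)$. Then $$\Delta(9)\le r_{\mathrm{tilt}}=0.000127349686128355334123703774\ldots .$$ Moreover, among all nine-triangle dissections of the unit square having the tilted-strip topology, the minimum possible area range is exactly $r_{\mathrm{tilt}}$.
   Context: A dissection of the unit square $[0,1]^2$ into $n$ triangles is a collection of $n$ nondegenerate (positive-area) closed triangles with pairwise disjoint interiors whose union is the square; T-junctions are allowed (a vertex of one triangle may lie in the relative interior of a side of another). If $D$ is a dissection whose triangles have areas $a_1,\dots,a_n$, its area range is $R(D)=\max_i a_i-\min_i a_i$, and $\Delta(n)=\inf_D R(D)$ over all dissections of the unit square into $n$ nondegenerate triangles. Tilted-strip topology. Let $P=(0,0)$, $Q=(1,0)$, $T=(1,1)$, $S=(0,1)$ be the vertices of the unit square. Choose a point $E=(e,0)$ with $0<e<1$ on the bottom side, a point $F=(f,1)$ with $0<f<1$ on the top side, and a point $R$ in the open segment $EF$. The quadrilateral $EQTF$ is divided by its diagonal $ET$ into the two triangles $EQT$ (area $b_1$, so $e=1-2b_1$) and $ETF$ (area $b_2$, so $f=1-2b_2$). The triangle $SFR$ (the upper cap) has area $c$, so that $R=(e+(f-e)Y,Y)$ with $Y=1-2c/f$. The remaining quadrilateral $PERS$ is cut into six triangles, of areas $a_1,\dots,a_6$ in order, by a zig-zag from the segment $PS$ to the segment $ER$ between the lower rail $PE$ and the upper rail $SR$, with direction sequence $(-,+,-,+,+,-)$,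 where $-$ means that the step advances along the lower rail and $+$ that it advances along the upper rail. Explicitly, there are points $p_1,p_2$ on the segment $PE$, with $P,p_1,p_2,E$ distinct and in this order, and points $u_1,u_2$ on the segment $SR$, with $S,u_1,u_2,R$ distinct and in this order, and the six triangles are, in order, $Pp_1S$, $p_1Su_1$, $p_1p_2u_1$, $p_2u_1u_2$, $p_2u_2R$, $p_2ER$. A nine-triangle dissection has the tilted-strip topology if it consists of the nine triangles $EQT$, $ETF$, $SFR$ and these six triangles for some such choice of points; the nine areas $c,a_1,\dots,a_6,b_1,b_2$ are arbitrary positive numbers with sum $1$, subject only to being realized by such a configuration. *)

theory Defs
  imports "HOL-Analysis.Analysis"
begin

definition triangle :: "real^2 \<Rightarrow> real^2 \<Rightarrow> real^2 \<Rightarrow> (real^2) set" where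
  "triangle A B C = convex hull {A, B, C}"

definition area :: "(real^2) set \<Rightarrow> real" where
  "area A = measure lborel A"

definition nondegenerate_triangle :: "(real^2) set \<Rightarrow> bool" where
  "nondegenerate_triangle t \<longleftrightarrow> (\<exists>A B C. t = triangle A B C) \<and> area t > 0"

definition unit_square :: "(real^2) set" where
  "unit_square = cbox (vector [0, 0]) (vector [1, 1])"

definition dissection :: "nat \<Rightarrow> (real^2) set set \<Rightarrow> bool" where
  "dissection n D \<longleftrightarrow>
     finite D \<and> card D = n \<and>
     (\<forall>t\<in>D. nondegenerate_triangle t) \<and>
     (\<forall>s\<in>D. \<forall>t\<in>D. s \<noteq> t \<longrightarrow> interior s \<inter> interior t = {}) \<and>
     \<Union>D = unit_square"

definition area_range :: "(real^2) set set \<Rightarrow> real" where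
  "area_range D = Max (area ` D) - Min (area ` D)"

text \<open>The real infimum below is meaningful for every \<open>n \<ge> 2\<close>; for \<open>n < 2\<close> there are no
  dissections and its value is unspecified.\<close>

definition Delta :: "nat \<Rightarrow> real" where
  "Delta n = (INF D \<in> {D. dissection n D}. area_range D)"

text \<open>Points \<open>a, b, c, d\<close> are distinct and occur in this order on the segment from \<open>a\<close> to \<open>d\<close>.
  Since \<open>open_segment x x = {}\<close>, distinctness is included.\<close>

definition in_order :: "real^2 \<Rightarrow> real^2 \<Rightarrow> real^2 \<Rightarrow> real^2 \<Rightarrow> bool" where
  "in_order a b c d \<longleftrightarrow> c \<in> open_segment a d \<and> b \<in> open_segment a c"

definition tilted_strip :: "(real^2) set set \<Rightarrow> bool" where
  "tilted_strip D \<longleftrightarrow> dissection 9 D \<and>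
     (\<exists>P Q T S E F R p1 p2 u1 u2 :: real^2. \<exists>e f :: real.
        P = vector [0, 0] \<and> Q = vector [1, 0] \<and> T = vector [1, 1] \<and> S = vector [0, 1] \<and>
        0 < e \<and> e < 1 \<and> E = vector [e, 0] \<and>
        0 < f \<and> f < 1 \<and> F = vector [f, 1] \<and>
        R \<in> open_segment E F \<and>
        in_order P p1 p2 E \<and> in_order S u1 u2 R \<and>
        D = {triangle E Q T, triangle E T F, triangle S F R,
             triangle P p1 S, triangle p1 S u1, triangle p1 p2 u1,
             triangle p2 u1 u2, triangle p2 u2 R, triangle p2 E R})"

definition tilt_poly :: "real \<Rightarrow> real" where
  "tilt_poly r = 4864 * r^4 - 824 * r^3 - 18804 * r^2 - 7850 * r + 1"

definition r_tilt :: real where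
  "r_tilt = (THE r. r \<in> {0.000127<..<0.000128} \<and> tilt_poly r = 0)"

end

theory Submission
  imports Defs
begin

text \<open>A tilted strip has six free parameters beyond the split of the total of \<open>a\<^sub>4\<close> and \<open>a\<^sub>5\<close>, while
  seven other areas are to be realized, so the areas satisfy one polynomial equation \<open>G = 0\<close>. At equal
  areas \<open>G = 1/6561\<close>, and on the hyperplane of total area \<open>1\<close> near that point \<open>G\<close> is monotone in each
  area, decreasing for \<open>b\<^sub>1, c, a\<^sub>1, a\<^sub>3, a\<^sub>6\<close> and increasing for \<open>b\<^sub>2, a\<^sub>2, a\<^sub>4, a\<^sub>5\<close>. Thus, for
  areas of range \<open>r\<close>, \<open>G\<close> is smallest when the former equal \<open>(1 + 4r)/9\<close> and the latter \<open>(1 - 5r)/9\<close>,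
  where it is \<open>p(r)/6561\<close>. This is positive for \<open>r < r_tilt\<close>, and for \<open>r = r_tilt\<close> the corner
  is realized by a configuration.\<close>

section \<open>Dissections into triangles\<close>

text \<open>Twice the signed area of the triangle, positive when \<open>A\<close>, \<open>B\<close>,
  \<open>C\<close> run counterclockwise.\<close>

definition orient :: "real^2 \<Rightarrow> real^2 \<Rightarrow> real^2 \<Rightarrow> real" where
  "orient A B C = (B $ 1 - A $ 1) * (C $ 2 - A $ 2) - (C $ 1 - A $ 1) * (B $ 2 - A $ 2)"

lemma area_triangle: "area (triangle A B C) = \<bar>orient A B C\<bar> / 2"
  unfolding area_def triangle_def content_triangle orient_def
  by (simp add: abs_minus_commute algebra_simps)

text \<open>Divided by \<open>orient A B C\<close>, the three orientations at \<open>z\<close> are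
  its barycentric coordinates, so nonnegative ones place \<open>z\<close> in the triangle.\<close>

lemma mem_triangle_if_orient:
  assumes "0 < orient A B C" "0 \<le> orient A B z" "0 \<le> orient B C z" "0 \<le> orient C A z"
  shows "z \<in> triangle A B C"
proof -
  define d where "d = orient A B C"
  have sum: "orient B C z + orient C A z + orient A B z = d"
    unfolding d_def orient_def by (simp add: algebra_simps)
  have "d * z $ i = orient B C z * A $ i + orient C A z * B $ i + orient A B z * C $ i" for i
    using exhaust_2[of i] unfolding d_def orient_def by (auto simp: algebra_simps)
  then have "z = (orient B C z / d) *\<^sub>R A + (orient C A z / d) *\<^sub>R B + (orient A B z / d) *\<^sub>R C"
    using assms(1) unfolding vec_eq_iff d_def by (simp add: field_simps)
  moreover have "orient B C z / d + orient C A z / d + orient A B z / d = 1"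
    using sum assms(1) by (simp add: d_def flip: add_divide_distrib)
  ultimately show ?thesis
    unfolding triangle_def convex_hull_3 using assms by (force simp: d_def)
qed

lemma triangle_subset_unit_square:
  assumes "A \<in> unit_square" "B \<in> unit_square" "C \<in> unit_square"
  shows "triangle A B C \<subseteq> unit_square"
  unfolding triangle_def using assms
  by (intro hull_minimal) (auto simp: unit_square_def convex_box)

lemma vector_mem_unit_square [simp]:
  "vector [x, y] \<in> unit_square \<longleftrightarrow> 0 \<le> x \<and> x \<le> 1 \<and> 0 \<le> y \<and> y \<le> (1::real)"
  unfolding unit_square_def by (auto simp: mem_box_cart forall_2)

lemma area_unit_square: "area unit_square = 1"
proof -
  have "vector [0, 0] \<in> unit_square" by simp
  then have "unit_square \<noteq> {}" by blast
  then show ?thesis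
    unfolding area_def unit_square_def by (simp add: content_cbox_cart UNIV_2)
qed

lemma compact_triangle: "compact (triangle A B C)"
  unfolding triangle_def by (simp add: finite_imp_compact_convex_hull)

lemma interior_nonempty_if_area_pos:
  assumes "0 < area (triangle A B C)"
  shows "interior (triangle A B C) \<noteq> {}"
proof
  assume "interior (triangle A B C) = {}"
  then have "negligible (triangle A B C)"
    by (simp add: triangle_def negligible_convex_interior)
  then have "measure lebesgue (triangle A B C) = 0"
    by (simp add: negligible_imp_measure0)
  moreover have "measure lebesgue (triangle A B C) = area (triangle A B C)"
    unfolding area_def by (rule measure_completion) (simp add: borel_compact compact_triangle)
  ultimately show False using assms by simp
qed

text \<open>An overlap of two interiors would be open, hence of positive measure, and would make the
  sum of the areas exceed the area of the union.\<close>

lemma interiors_disjoint_if_cover: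
  assumes I: "finite I" and T: "\<And>i. i \<in> I \<Longrightarrow> compact (T i)"
    and cover: "(\<Union>i\<in>I. T i) = S" and sum: "(\<Sum>i\<in>I. area (T i)) = area S"
    and ij: "i \<in> I" "j \<in> I" "i \<noteq> j"
  shows "interior (T i) \<inter> interior (T j) = {}"
proof (rule ccontr)
  define U where "U = interior (T i) \<inter> interior (T j)"
  assume "interior (T i) \<inter> interior (T j) \<noteq> {}"
  then obtain x d where "0 < d" and ball: "ball x d \<subseteq> U"
    unfolding U_def by (metis all_not_in_conv open_Int open_contains_ball open_interior)
  have fin: "T k \<in> fmeasurable lborel" if "k \<in> I" for k
    using T[OF that] by (simp add: fmeasurable_compact)
  have U: "U \<in> fmeasurable lborel"
    by (rule fmeasurableI2[OF fin[OF ij(1)]]) (use interior_subset in \<open>auto simp: U_def\<close>)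
  have "0 < measure lborel (ball x d)"
    using \<open>0 < d\<close> by (simp add: content_ball_pos)
  also have "\<dots> \<le> measure lborel U"
    by (rule measure_mono_fmeasurable[OF ball _ U]) simp
  finally have pos: "0 < measure lborel U" .
  have TU: "measure lborel (T i - U) = measure lborel (T i) - measure lborel U"
    by (rule measurable_measure_Diff[OF fin[OF ij(1)]])
      (use interior_subset in \<open>auto simp: U_def fmeasurableD\<close>)
  \<comment> \<open>Cutting \<open>U\<close> out of \<open>T i\<close> uncovers nothing, since
    \<open>T j\<close> still contains \<open>U\<close>, but lowers the total measure by that of
    \<open>U\<close>.\<close>
  define T' where "T' k = (if k = i then T i - U else T k)" for k
  have "S = (\<Union>k\<in>I. T' k)"
  proof
    show "S \<subseteq> (\<Union>k\<in>I. T' k)"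
    proof
      fix z assume "z \<in> S"
      then obtain k where k: "k \<in> I" "z \<in> T k" using cover by blast
      show "z \<in> (\<Union>k\<in>I. T' k)"
      proof (cases "z \<in> U")
        case True
        then have "z \<in> T' j" using ij(3) interior_subset[of "T j"] by (auto simp: T'_def U_def)
        then show ?thesis using ij(2) by blast
      next
        case False
        then have "z \<in> T' k" using k by (auto simp: T'_def)
        then show ?thesis using k(1) by blast
      qed
    qed
    show "(\<Union>k\<in>I. T' k) \<subseteq> S"
      using cover by (auto simp: T'_def split: if_splits)
  qed
  moreover have "measure lborel (\<Union>k\<in>I. T' k) \<le> (\<Sum>k\<in>I. measure lborel (T' k))"
    using I fin U by (intro measure_UNION_le) (auto simp: T'_def fmeasurable_def)
  moreover have "(\<Sum>k\<in>I. measure lborel (T' k)) = (\<Sum>k\<in>I. area (T k)) - measure lborel U"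
    using I ij(1) TU by (simp add: sum.remove[of I i] T'_def area_def)
  ultimately show False using sum pos by (simp add: area_def)
qed

text \<open>Covering the square with total area 1 already forces disjoint interiors, so no pair of
  triangles has to be compared. A list keeps the areas with multiplicity; its entries are distinct
  because their interiors are disjoint and nonempty.\<close>

lemma dissectionI:
  assumes xs: "\<And>t. t \<in> set xs \<Longrightarrow> nondegenerate_triangle t"
    and cover: "\<Union>(set xs) = unit_square" and sum: "sum_list (map area xs) = 1"
  shows "dissection (length xs) (set xs)"
proof -
  have disj: "interior (xs ! i) \<inter> interior (xs ! j) = {}"
    if "i < length xs" "j < length xs" "i \<noteq> j" for i j
  proof (rule interiors_disjoint_if_cover[where I = "{..<length xs}" and S = unit_square])
    show "compact (xs ! i)" if "i \<in> {..<length xs}" for i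
      using xs[of "xs ! i"] that by (auto simp: nondegenerate_triangle_def compact_triangle)
    show "(\<Union>i\<in>{..<length xs}. xs ! i) = unit_square"
      unfolding cover[symmetric] set_conv_nth by blast
    show "(\<Sum>i\<in>{..<length xs}. area (xs ! i)) = area unit_square"
      using sum by (simp add: area_unit_square sum_list_sum_nth atLeast0LessThan)
  qed (use that in auto)
  have "xs ! i \<noteq> xs ! j" if "i < length xs" "j < length xs" "i \<noteq> j" for i j
    using disj[OF that] xs[of "xs ! i"] that interior_nonempty_if_area_pos
    by (auto simp: nondegenerate_triangle_def)
  then have "distinct xs" by (auto simp: distinct_conv_nth)
  moreover have "interior s \<inter> interior t = {}" if "s \<in> set xs" "t \<in> set xs" "s \<noteq> t" for s t
    using that disj by (metis in_set_conv_nth)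
  ultimately show ?thesis
    unfolding dissection_def using xs cover by (simp add: distinct_card)
qed

section \<open>Tilted strips\<close>

definition strip_params :: "real \<Rightarrow> real \<Rightarrow> real \<Rightarrow> real \<Rightarrow> real \<Rightarrow> real \<Rightarrow> real \<Rightarrow> bool" where
  "strip_params e f k x1 x2 s1 s2 \<longleftrightarrow> 0 < e \<and> e < 1 \<and> 0 < f \<and> f < 1 \<and> 0 < k \<and> k < 1 \<and>
     0 < x1 \<and> x1 < x2 \<and> x2 < e \<and> 0 < s1 \<and> s1 < s2 \<and> s2 < 1"

text \<open>In the coordinates \<open>k = 1 - Y\<close>, \<open>p\<^sub>i = (x\<^sub>i, 0)\<close> and \<open>u\<^sub>i = S + s\<^sub>i (R - S)\<close>.\<close>

definition strip_triangles ::
    "real \<Rightarrow> real \<Rightarrow> real \<Rightarrow> real \<Rightarrow> real \<Rightarrow> real \<Rightarrow> real \<Rightarrow> (real^2) set list" where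
  "strip_triangles e f k x1 x2 s1 s2 =
     (let P = vector [0, 0]; Q = vector [1, 0]; T = vector [1, 1]; S = vector [0, 1];
          E = vector [e, 0]; F = vector [f, 1]; rx = f - k * (f - e);
          R = vector [rx, 1 - k]; p1 = vector [x1, 0]; p2 = vector [x2, 0];
          u1 = vector [s1 * rx, 1 - s1 * k]; u2 = vector [s2 * rx, 1 - s2 * k]
      in [triangle E Q T, triangle E T F, triangle S F R,
          triangle P p1 S, triangle p1 S u1, triangle p1 p2 u1,
          triangle p2 u1 u2, triangle p2 u2 R, triangle p2 E R])"

text \<open>The order is \<open>b1, b2, c, a1, ..., a6\<close>. The factor \<open>rx - x * k\<close>
  is twice the area of the triangle with vertices \<open>(x, 0)\<close>, \<open>S\<close>,
  \<open>R\<close>.\<close>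

definition strip_areas ::
    "real \<Rightarrow> real \<Rightarrow> real \<Rightarrow> real \<Rightarrow> real \<Rightarrow> real \<Rightarrow> real \<Rightarrow> real list" where
  "strip_areas e f k x1 x2 s1 s2 =
     (let rx = f - k * (f - e)
      in [(1 - e) / 2, (1 - f) / 2, f * k / 2,
          x1 / 2, s1 * (rx - x1 * k) / 2, (x2 - x1) * (1 - s1 * k) / 2,
          (s2 - s1) * (rx - x2 * k) / 2, (1 - s2) * (rx - x2 * k) / 2, (e - x2) * (1 - k) / 2])"

lemma sum_list_strip_areas: "sum_list (strip_areas e f k x1 x2 s1 s2) = 1"
  unfolding strip_areas_def Let_def by (simp add: field_simps)

text \<open>The expression is \<open>(1 - k) * f + k * (e - x)\<close>. Its positivity says that
  \<open>(x, 0)\<close> lies strictly below the line \<open>SR\<close>.\<close>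

lemma strip_params_height_pos:
  assumes "strip_params e f k x1 x2 s1 s2" "x < e"
  shows "0 < f - k * (f - e) - x * k"
proof -
  have "0 < (1 - k) * f" "0 < k * (e - x)" using assms by (simp_all add: strip_params_def)
  then show ?thesis by (simp add: algebra_simps)
qed

lemma strip_params_mult_less_1:
  assumes "strip_params e f k x1 x2 s1 s2"
  shows "s1 * k < 1" "s2 * k < 1"
  using assms mult_strict_mono[of s1 1 k 1] mult_strict_mono[of s2 1 k 1]
  by (simp_all add: strip_params_def)

lemma strip_areas_pos:
  assumes "strip_params e f k x1 x2 s1 s2"
  shows "list_all ((<) 0) (strip_areas e f k x1 x2 s1 s2)"
  using assms strip_params_height_pos[OF assms, of x1] strip_params_height_pos[OF assms, of x2]
    strip_params_mult_less_1[OF assms]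
  unfolding strip_areas_def Let_def strip_params_def by simp

lemma area_triangle_eq:
  assumes "orient A B C = 2 * a \<or> orient A B C = - 2 * a" "0 < a"
  shows "area (triangle A B C) = a"
  using assms unfolding area_triangle by auto

lemma map_area_strip_triangles:
  assumes "strip_params e f k x1 x2 s1 s2"
  shows "map area (strip_triangles e f k x1 x2 s1 s2) = strip_areas e f k x1 x2 s1 s2"
proof -
  note pos = strip_areas_pos[OF assms, unfolded strip_areas_def Let_def list.pred_inject]
  show ?thesis
    unfolding strip_areas_def strip_triangles_def Let_def list.map list.inject
    by (intro conjI refl area_triangle_eq;
        ((insert pos, elim conjE, assumption) | simp add: orient_def algebra_simps))
qed

lemma strip_triangles_cover:
  assumes par: "strip_params e f k x1 x2 s1 s2"
  shows "\<Union>(set (strip_triangles e f k x1 x2 s1 s2)) = unit_square"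
proof
  define rx where "rx = f - k * (f - e)"
  have par': "0 < e" "e < 1" "0 < f" "f < 1" "0 < k" "k < 1" "0 < x1" "x1 < x2" "x2 < e"
      "0 < s1" "s1 < s2" "s2 < 1" "x1 < e"
    using par by (auto simp: strip_params_def)
  note h = strip_params_height_pos[OF par, folded rx_def] and sk = strip_params_mult_less_1[OF par]
  have rx: "0 < rx" using h[of 0] par' by simp
  have "rx < 1"
  proof -
    have "rx = (1 - k) * f + k * e" unfolding rx_def by (simp add: algebra_simps)
    also have "\<dots> < (1 - k) * 1 + k * 1"
      using par' by (intro add_strict_mono mult_strict_left_mono) auto
    finally show ?thesis by simp
  qed
  then have srx: "s1 * rx < 1" "s2 * rx < 1"
    using par' rx mult_strict_mono[of s1 1 rx 1] mult_strict_mono[of s2 1 rx 1] by simp_all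
  show "\<Union>(set (strip_triangles e f k x1 x2 s1 s2)) \<subseteq> unit_square"
    unfolding strip_triangles_def Let_def rx_def[symmetric]
    using par' rx \<open>rx < 1\<close> srx sk by (simp add: triangle_subset_unit_square)
  let ?P = "vector [0, 0] :: real^2" and ?Q = "vector [1, 0] :: real^2"
    and ?T = "vector [1, 1] :: real^2" and ?S = "vector [0, 1] :: real^2"
    and ?E = "vector [e, 0] :: real^2" and ?F = "vector [f, 1] :: real^2"
    and ?R = "vector [rx, 1 - k] :: real^2"
    and ?p1 = "vector [x1, 0] :: real^2" and ?p2 = "vector [x2, 0] :: real^2"
    and ?u1 = "vector [s1 * rx, 1 - s1 * k] :: real^2"
    and ?u2 = "vector [s2 * rx, 1 - s2 * k] :: real^2"
  show "unit_square \<subseteq> \<Union>(set (strip_triangles e f k x1 x2 s1 s2))"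
  proof
    fix z :: "real^2"
    assume "z \<in> unit_square"
    then have z: "0 \<le> z $ 1" "z $ 1 \<le> 1" "0 \<le> z $ 2" "z $ 2 \<le> 1"
      unfolding unit_square_def by (auto simp: mem_box_cart forall_2)
    have swap: "orient B A z = - orient A B z" for A B
      by (simp add: orient_def algebra_simps)
    have bottom: "orient (vector [a, 0]) (vector [b, 0]) z = (b - a) * z $ 2" for a b
      by (simp add: orient_def)
    have top: "orient (vector [b, 1]) (vector [a, 1]) z = (b - a) * (1 - z $ 2)" for a b
      by (simp add: orient_def algebra_simps)
    have left: "orient ?S ?P z = z $ 1" and right: "orient ?Q ?T z = 1 - z $ 1"
      by (simp_all add: orient_def)
    \<comment> \<open>Since \<open>R\<close> lies on \<open>EF\<close>, and \<open>u1\<close>,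
      \<open>u2\<close> lie on \<open>SR\<close>, the sign for the whole segment decides the sign
      for each of its pieces.\<close>
    have EF: "orient ?R ?F z = k * orient ?E ?F z" "orient ?E ?R z = (1 - k) * orient ?E ?F z"
      by (simp_all add: orient_def rx_def algebra_simps)
    have SR: "orient ?S ?u1 z = s1 * orient ?S ?R z" "orient ?u1 ?u2 z = (s2 - s1) * orient ?S ?R z"
        "orient ?u2 ?R z = (1 - s2) * orient ?S ?R z"
      by (simp_all add: orient_def algebra_simps)
    have pos: "0 < orient ?E ?Q ?T" "0 < orient ?E ?T ?F" "0 < orient ?S ?R ?F"
        "0 < orient ?P ?p1 ?S" "0 < orient ?p1 ?u1 ?S" "0 < orient ?p1 ?p2 ?u1"
        "0 < orient ?p2 ?u2 ?u1" "0 < orient ?p2 ?R ?u2" "0 < orient ?p2 ?E ?R"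
    proof -
      have "orient ?E ?T ?F = 1 - f" "orient ?S ?R ?F = f * k"
          "orient ?p1 ?u1 ?S = s1 * (rx - x1 * k)" "orient ?p2 ?u2 ?u1 = (s2 - s1) * (rx - x2 * k)"
          "orient ?p2 ?R ?u2 = (1 - s2) * (rx - x2 * k)"
        by (simp_all add: orient_def algebra_simps)
      then show "0 < orient ?E ?T ?F" "0 < orient ?S ?R ?F" "0 < orient ?p1 ?u1 ?S"
          "0 < orient ?p2 ?u2 ?u1" "0 < orient ?p2 ?R ?u2"
        using par' h by simp_all
    qed (use par' sk in \<open>simp_all add: orient_def\<close>)
    note mem = mem_triangle_if_orient
    \<comment> \<open>The line \<open>EF\<close> splits off the two right triangles and
      \<open>SR\<close> the cap. In the remaining quadrilateral the zig-zag segments are tried from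
      left to right, and the first with \<open>z\<close> on its left determines the
      triangle.\<close>
    consider "orient ?E ?F z \<le> 0" "orient ?E ?T z \<le> 0"
      | "orient ?E ?F z \<le> 0" "0 \<le> orient ?E ?T z"
      | "0 \<le> orient ?E ?F z" "0 \<le> orient ?S ?R z"
      | "0 \<le> orient ?E ?F z" "orient ?S ?R z \<le> 0" "0 \<le> orient ?p1 ?S z"
      | "orient ?S ?R z \<le> 0" "orient ?p1 ?S z \<le> 0" "0 \<le> orient ?p1 ?u1 z"
      | "orient ?S ?R z \<le> 0" "orient ?p1 ?u1 z \<le> 0" "0 \<le> orient ?p2 ?u1 z"
      | "orient ?S ?R z \<le> 0" "orient ?p2 ?u1 z \<le> 0" "0 \<le> orient ?p2 ?u2 z"
      | "orient ?S ?R z \<le> 0" "orient ?p2 ?u2 z \<le> 0" "0 \<le> orient ?p2 ?R z"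
      | "0 \<le> orient ?E ?F z" "orient ?p2 ?R z \<le> 0"
      by linarith
    then show "z \<in> \<Union>(set (strip_triangles e f k x1 x2 s1 s2))"
    proof cases
      case 1
      then have "z \<in> triangle ?E ?Q ?T"
        using par' z by (intro mem pos(1)) (simp_all add: bottom right swap[of ?T])
      then show ?thesis by (simp add: strip_triangles_def Let_def)
    next
      case 2
      then have "z \<in> triangle ?E ?T ?F"
        using par' z by (intro mem pos(2)) (simp_all add: top swap[of ?F])
      then show ?thesis by (simp add: strip_triangles_def Let_def)
    next
      case 3
      then have "z \<in> triangle ?S ?R ?F"
        using par' z by (intro mem pos(3)) (simp_all add: top EF)
      \<comment> \<open>Membership was shown for the counterclockwise order, whereas the
        configuration lists this triangle clockwise.\<close>
      then have "z \<in> triangle ?S ?F ?R" by (simp add: triangle_def insert_commute)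
      then show ?thesis by (simp add: strip_triangles_def Let_def rx_def)
    next
      case 4
      then have "z \<in> triangle ?P ?p1 ?S"
        using par' z by (intro mem pos(4)) (simp_all add: bottom left)
      then show ?thesis by (simp add: strip_triangles_def Let_def)
    next
      case 5
      then have "z \<in> triangle ?p1 ?u1 ?S"
        using par' z by (intro mem pos(5)) (simp_all add: SR swap[of ?u1] swap[of ?S ?p1] mult_nonneg_nonpos)
      then have "z \<in> triangle ?p1 ?S ?u1" by (simp add: triangle_def insert_commute)
      then show ?thesis by (simp add: strip_triangles_def Let_def rx_def)
    next
      case 6
      then have "z \<in> triangle ?p1 ?p2 ?u1"
        using par' z by (intro mem pos(6)) (simp_all add: bottom swap[of ?u1])
      then show ?thesis by (simp add: strip_triangles_def Let_def rx_def)
    next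
      case 7
      then have "z \<in> triangle ?p2 ?u2 ?u1"
        using par' z by (intro mem pos(7)) (simp_all add: SR swap[of ?u2 ?u1] swap[of ?u1 ?p2] mult_nonneg_nonpos)
      then have "z \<in> triangle ?p2 ?u1 ?u2" by (simp add: triangle_def insert_commute)
      then show ?thesis by (simp add: strip_triangles_def Let_def rx_def)
    next
      case 8
      then have "z \<in> triangle ?p2 ?R ?u2"
        using par' z by (intro mem pos(8)) (simp_all add: SR swap[of ?R ?u2] swap[of ?u2 ?p2] mult_nonneg_nonpos)
      then have "z \<in> triangle ?p2 ?u2 ?R" by (simp add: triangle_def insert_commute)
      then show ?thesis by (simp add: strip_triangles_def Let_def rx_def)
    next
      case 9
      then have "z \<in> triangle ?p2 ?E ?R"
        using par' z by (intro mem pos(9)) (simp_all add: bottom EF swap[of ?R])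
      then show ?thesis by (simp add: strip_triangles_def Let_def rx_def)
    qed
  qed
qed

section \<open>Tilted strips as a parametrized family\<close>

lemma open_segmentI:
  assumes "a \<noteq> b" "0 < t" "t < 1" "x = (1 - t) *\<^sub>R a + t *\<^sub>R b"
  shows "x \<in> open_segment a b"
  using assms unfolding in_segment by blast

lemma vec2_eq_iff: "x = y \<longleftrightarrow> x $ 1 = y $ 1 \<and> x $ 2 = y $ (2 :: 2)"
  by (simp add: vec_eq_iff forall_2)

text \<open>Ratios along the open segments give the parameters. Conversely every admissible tuple
  yields a dissection, by the cover and the total area.\<close>

lemma tilted_strip_iff:
  "tilted_strip D \<longleftrightarrow> (\<exists>e f k x1 x2 s1 s2.
     strip_params e f k x1 x2 s1 s2 \<and> D = set (strip_triangles e f k x1 x2 s1 s2))"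
proof
  assume "tilted_strip D"
  then obtain P Q T S E F R p1 p2 u1 u2 :: "real^2" and e f :: real where
    pts: "P = vector [0, 0]" "Q = vector [1, 0]" "T = vector [1, 1]" "S = vector [0, 1]"
      "E = vector [e, 0]" "F = vector [f, 1]" and ef: "0 < e" "e < 1" "0 < f" "f < 1"
    and R: "R \<in> open_segment E F" and p: "in_order P p1 p2 E" and u: "in_order S u1 u2 R"
    and D: "D = {triangle E Q T, triangle E T F, triangle S F R,
             triangle P p1 S, triangle p1 S u1, triangle p1 p2 u1,
             triangle p2 u1 u2, triangle p2 u2 R, triangle p2 E R}"
    unfolding tilted_strip_def by blast
  from R obtain t where t: "0 < t" "t < 1" "R = (1 - t) *\<^sub>R E + t *\<^sub>R F"
    unfolding in_segment by blast
  from p obtain a b where a: "0 < a" "a < 1" "p2 = (1 - a) *\<^sub>R P + a *\<^sub>R E"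
    and b: "0 < b" "b < 1" "p1 = (1 - b) *\<^sub>R P + b *\<^sub>R p2"
    unfolding in_order_def in_segment by blast
  from u obtain c d where c: "0 < c" "c < 1" "u2 = (1 - c) *\<^sub>R S + c *\<^sub>R R"
    and d: "0 < d" "d < 1" "u1 = (1 - d) *\<^sub>R S + d *\<^sub>R u2"
    unfolding in_order_def in_segment by blast
  \<comment> \<open>The first point on each rail is given relative to the second one, so the ratios
    multiply.\<close>
  have "strip_params e f (1 - t) (b * (a * e)) (a * e) (d * c) c"
    unfolding strip_params_def using ef t a b c d by simp
  moreover have R': "R = vector [f - (1 - t) * (f - e), 1 - (1 - t)]"
    unfolding t pts vec2_eq_iff by (simp add: algebra_simps)
  moreover have p2': "p2 = vector [a * e, 0]"
    unfolding a(3) pts vec2_eq_iff by simp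
  moreover have "p1 = vector [b * (a * e), 0]"
    unfolding b(3) p2' pts vec2_eq_iff by simp
  moreover have u2': "u2 = vector [c * (f - (1 - t) * (f - e)), 1 - c * (1 - t)]"
    unfolding c(3) R' pts vec2_eq_iff by (simp add: algebra_simps)
  moreover have "u1 = vector [d * c * (f - (1 - t) * (f - e)), 1 - d * c * (1 - t)]"
    unfolding d(3) u2' pts vec2_eq_iff by (simp add: algebra_simps)
  ultimately have "strip_params e f (1 - t) (b * (a * e)) (a * e) (d * c) c \<and>
      D = set (strip_triangles e f (1 - t) (b * (a * e)) (a * e) (d * c) c)"
    unfolding D pts strip_triangles_def Let_def by simp
  then show "\<exists>e f k x1 x2 s1 s2. strip_params e f k x1 x2 s1 s2 \<and>
      D = set (strip_triangles e f k x1 x2 s1 s2)" by blast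
next
  assume "\<exists>e f k x1 x2 s1 s2. strip_params e f k x1 x2 s1 s2 \<and>
      D = set (strip_triangles e f k x1 x2 s1 s2)"
  then obtain e f k x1 x2 s1 s2 where par: "strip_params e f k x1 x2 s1 s2"
    and D: "D = set (strip_triangles e f k x1 x2 s1 s2)" by blast
  define rx where "rx = f - k * (f - e)"
  have rx: "0 < rx" using strip_params_height_pos[OF par, of 0] par by (simp add: rx_def strip_params_def)
  note par' = par[unfolded strip_params_def]
  have "dissection (length (strip_triangles e f k x1 x2 s1 s2)) D"
    unfolding D
  proof (rule dissectionI)
    show "\<Union>(set (strip_triangles e f k x1 x2 s1 s2)) = unit_square"
      by (rule strip_triangles_cover[OF par])
    show "sum_list (map area (strip_triangles e f k x1 x2 s1 s2)) = 1"
      unfolding map_area_strip_triangles[OF par] by (rule sum_list_strip_areas)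
    fix t
    assume t: "t \<in> set (strip_triangles e f k x1 x2 s1 s2)"
    have "0 < area t"
      using t strip_areas_pos[OF par] unfolding map_area_strip_triangles[OF par, symmetric]
      by (simp add: list_all_iff)
    moreover have "\<exists>A B C. t = triangle A B C"
      using t unfolding strip_triangles_def Let_def by auto
    ultimately show "nondegenerate_triangle t" unfolding nondegenerate_triangle_def by simp
  qed
  moreover have "length (strip_triangles e f k x1 x2 s1 s2) = 9"
    by (simp add: strip_triangles_def Let_def)
  ultimately have dis: "dissection 9 D" by metis
  let ?P = "vector [0, 0] :: real^2" and ?S = "vector [0, 1] :: real^2"
    and ?E = "vector [e, 0] :: real^2" and ?F = "vector [f, 1] :: real^2"
    and ?R = "vector [rx, 1 - k] :: real^2"
    and ?p1 = "vector [x1, 0] :: real^2" and ?p2 = "vector [x2, 0] :: real^2"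
    and ?u1 = "vector [s1 * rx, 1 - s1 * k] :: real^2"
    and ?u2 = "vector [s2 * rx, 1 - s2 * k] :: real^2"
  have "?R \<in> open_segment ?E ?F"
    using par' by (intro open_segmentI[of _ _ "1 - k"]) (simp_all add: vec2_eq_iff rx_def algebra_simps)
  moreover have "in_order ?P ?p1 ?p2 ?E"
    unfolding in_order_def
  proof
    show "?p2 \<in> open_segment ?P ?E"
      using par' by (intro open_segmentI[of _ _ "x2 / e"]) (simp_all add: vec2_eq_iff)
    show "?p1 \<in> open_segment ?P ?p2"
      using par' by (intro open_segmentI[of _ _ "x1 / x2"]) (simp_all add: vec2_eq_iff)
  qed
  moreover have "in_order ?S ?u1 ?u2 ?R"
    unfolding in_order_def
  proof
    show "?u2 \<in> open_segment ?S ?R"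
      using par' rx by (intro open_segmentI[of _ _ s2]) (simp_all add: vec2_eq_iff algebra_simps)
    show "?u1 \<in> open_segment ?S ?u2"
      using par' rx by (intro open_segmentI[of _ _ "s1 / s2"]) (simp_all add: vec2_eq_iff field_simps)
  qed
  ultimately show "tilted_strip D"
    using dis par' unfolding tilted_strip_def D strip_triangles_def Let_def rx_def list.set by blast
qed

section \<open>The relation between the areas\<close>

text \<open>The areas other than \<open>a\<^sub>4\<close>, \<open>a\<^sub>5\<close> determine \<open>e\<close>, \<open>f\<close>, \<open>Y\<close>, \<open>p\<^sub>1\<close>, \<open>u\<^sub>1\<close>, \<open>p\<^sub>2\<close> with one equation left
  over, the one for \<open>a\<^sub>3\<close>. Cleared of denominators it is \<open>tilt_G = 0\<close>.\<close>

definition tilt_G :: "real \<Rightarrow> real \<Rightarrow> real \<Rightarrow> real \<Rightarrow> real \<Rightarrow> real \<Rightarrow> real \<Rightarrow> real" where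
  "tilt_G b1 b2 c a1 a2 a3 a6 =
     (let e = 1 - 2 * b1; f = 1 - 2 * b2; z = f - 2 * c; g = e - 2 * a1; w = f * z + 2 * c * g
      in (g * z - 2 * a6 * f) * (w - 4 * a2 * c) - 2 * a3 * w * z)"

text \<open>With \<open>h = f - k * (f - e) - x1 * k\<close> one gets \<open>z = f * (1 - k)\<close>
  and \<open>w = f * h\<close>; the two factors of the product become
  \<open>f * (1 - k) * (x2 - x1)\<close> and \<open>f * h * (1 - s1 * k)\<close>, and their product
  is \<open>2 * a3 * w * z\<close>.\<close>

lemma tilt_G_areas:
  "tilt_G ((1 - e) / 2) ((1 - f) / 2) (f * k / 2) (x1 / 2)
     (s1 * (f - k * (f - e) - x1 * k) / 2) ((x2 - x1) * (1 - s1 * k) / 2)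
     ((e - x2) * (1 - k) / 2) = 0"
  unfolding tilt_G_def Let_def by (simp add: field_simps)

text \<open>The values \<open>m\<close> and \<open>M\<close> are fixed by \<open>M - m = r\<close>
  and \<open>5 * M + 4 * m = 1\<close>, the total area with \<open>a4 = a5 = m\<close>.\<close>

lemma tilt_G_corner:
  fixes r :: real
  defines "m \<equiv> (1 - 5 * r) / 9" and "M \<equiv> (1 + 4 * r) / 9"
  shows "tilt_G M m M M m M M = tilt_poly r / 6561"
  unfolding tilt_G_def Let_def tilt_poly_def m_def M_def by (simp add: field_simps) algebra

text \<open>Expansion of the product about \<open>(x0, y0)\<close>; it serves as interval arithmetic
  for the coefficients below.\<close>

lemma near_mult:
  fixes x y :: real
  assumes "\<bar>x - x0\<bar> \<le> a" "\<bar>y - y0\<bar> \<le> b" "\<bar>x0\<bar> * b + \<bar>y0\<bar> * a + a * b \<le> d"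
  shows "\<bar>x * y - x0 * y0\<bar> \<le> d"
proof -
  have "x * y - x0 * y0 = x0 * (y - y0) + y0 * (x - x0) + (x - x0) * (y - y0)"
    by (simp add: algebra_simps)
  also have "\<bar>\<dots>\<bar> \<le> \<bar>x0\<bar> * \<bar>y - y0\<bar> + \<bar>y0\<bar> * \<bar>x - x0\<bar> + \<bar>x - x0\<bar> * \<bar>y - y0\<bar>"
    unfolding abs_mult[symmetric] by linarith
  also have "\<dots> \<le> \<bar>x0\<bar> * b + \<bar>y0\<bar> * a + a * b"
    using assms(1,2) by (intro add_mono mult_mono) auto
  finally show ?thesis using assms(3) by linarith
qed

lemma tilt_G_ge_corner:
  fixes b1 b2 c a1 a2 a3 a4 a5 a6 lo r :: real
  assumes box: "b1 \<in> {lo..lo + r}" "b2 \<in> {lo..lo + r}" "c \<in> {lo..lo + r}" "a1 \<in> {lo..lo + r}"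
      "a2 \<in> {lo..lo + r}" "a3 \<in> {lo..lo + r}" "a4 \<in> {lo..lo + r}" "a5 \<in> {lo..lo + r}"
      "a6 \<in> {lo..lo + r}"
    and total: "b1 + b2 + c + a1 + a2 + a3 + a4 + a5 + a6 = 1"
    and r: "r \<le> 0.000128"
  shows "tilt_poly r / 6561 \<le> tilt_G b1 b2 c a1 a2 a3 a6"
proof -
  define m where "m = (1 - 5 * r) / 9"
  define M where "M = (1 + 4 * r) / 9"
  define Z where "Z = 1 - 2 * b2 - 2 * c"
  define g where "g = 1 - 2 * b1 - 2 * a1"
  define W where "W = (1 - 2 * b2) * Z + 2 * (c * g)"
  define L where "L = W - 4 * (a2 * c)"
  define Z' where "Z' = 1 - 2 * m - 2 * M"
  define g' where "g' = 1 - 2 * M - 2 * M"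
  define W' where "W' = (1 - 2 * m) * Z' + 2 * (M * g')"
  define K' where "K' = g' * Z' - 2 * (M * (1 - 2 * m))"
  define V where "V = K' - 2 * (M * Z)"
  \<comment> \<open>These are divided differences mixing values at the given areas with primed
    values at the corner, so \<open>diff\<close> is exact, without remainder. The areas
    \<open>b1\<close> and \<open>a1\<close> enter only through \<open>g\<close> and share
    \<open>Db\<close>.\<close>
  define Db where "Db = - 2 * (Z * L + 2 * (V * M))"
  define D2 where "D2 = - 2 * (g' * L - 2 * (M * L) + V * (Z + (1 - 2 * m)) - 2 * (M * W'))"
  define Dc where "Dc = - 2 * (g' * L) + 2 * (V * (g - (1 - 2 * m))) - 4 * (m * K') + 4 * (M * W')"
  define Da2 where "Da2 = - 4 * (c * K')"
  define Da3 where "Da3 = - 2 * (W * Z)"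
  define Da6 where "Da6 = - 2 * ((1 - 2 * b2) * L)"
  have diff: "tilt_G b1 b2 c a1 a2 a3 a6 - tilt_G M m M M m M M =
      Db * (b1 - M) + Db * (a1 - M) + D2 * (b2 - m) + Dc * (c - M)
      + Da2 * (a2 - m) + Da3 * (a3 - M) + Da6 * (a6 - M)"
    unfolding tilt_G_def Let_def Db_def D2_def Dc_def Da2_def Da3_def Da6_def V_def K'_def W'_def
      L_def W_def Z_def g_def Z'_def g'_def by algebra
  \<comment> \<open>The mean of the nine areas is \<open>1/9\<close> and lies in the same interval
    of length \<open>r\<close>.\<close>
  have near: "\<bar>x - 1/9\<bar> \<le> 0.000128" if "x \<in> {lo..lo + r}" for x
    using that box total r unfolding atLeastAtMost_iff abs_le_iff by linarith
  note nears = box[THEN near]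
  have r0: "0 \<le> r" using box(1) by auto
  have mM: "\<bar>m - 1/9\<bar> \<le> 0.000128" "\<bar>M - 1/9\<bar> \<le> 0.000128"
    using r r0 unfolding m_def M_def by (auto simp: abs_le_iff field_simps)
  \<comment> \<open>From here on the centres are the values at nine equal areas, and the radii are
    rounded up.\<close>
  have f: "\<bar>(1 - 2 * b2) - 7/9\<bar> \<le> 0.000256" "\<bar>(1 - 2 * m) - 7/9\<bar> \<le> 0.000256"
    using nears(2) mM by linarith+
  have Z: "\<bar>Z - 5/9\<bar> \<le> 0.000512" "\<bar>Z' - 5/9\<bar> \<le> 0.000512"
    unfolding Z_def Z'_def using nears(2,3) mM by linarith+
  have g: "\<bar>g - 5/9\<bar> \<le> 0.000512" "\<bar>g' - 5/9\<bar> \<le> 0.000512"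
    unfolding g_def g'_def using nears(1,4) mM by linarith+
  have "\<bar>(1 - 2 * b2) * Z - 7/9 * (5/9)\<bar> \<le> 0.00055" "\<bar>c * g - 1/9 * (5/9)\<bar> \<le> 0.00013"
      "\<bar>(1 - 2 * m) * Z' - 7/9 * (5/9)\<bar> \<le> 0.00055" "\<bar>M * g' - 1/9 * (5/9)\<bar> \<le> 0.00013"
    by (rule near_mult, rule f Z g nears mM, rule f Z g nears mM, simp)+
  then have W: "\<bar>W - 5/9\<bar> \<le> 0.00082" "\<bar>W' - 5/9\<bar> \<le> 0.00082"
    unfolding W_def W'_def by linarith+
  have "\<bar>a2 * c - 1/9 * (1/9)\<bar> \<le> 0.00003"
    by (rule near_mult, rule nears, rule nears, simp)
  then have L: "\<bar>L - 41/81\<bar> \<le> 0.00095" unfolding L_def using W by linarith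
  have "\<bar>g' * Z' - 5/9 * (5/9)\<bar> \<le> 0.0006" "\<bar>M * (1 - 2 * m) - 1/9 * (7/9)\<bar> \<le> 0.00014"
    by (rule near_mult, rule f Z g nears mM, rule f Z g nears mM, simp)+
  then have K: "\<bar>K' - 11/81\<bar> \<le> 0.0009" unfolding K'_def abs_le_iff by (simp add: field_simps)
  have "\<bar>M * Z - 1/9 * (5/9)\<bar> \<le> 0.00014"
    by (rule near_mult, rule mM, rule Z, simp)
  then have V: "\<bar>V - 1/81\<bar> \<le> 0.0012" using K unfolding V_def abs_le_iff by (simp add: field_simps)
  have ZL: "\<bar>Z * L - 5/9 * (41/81)\<bar> \<le> 0.001"
    by (rule near_mult, rule Z, rule L, simp)
  have VM: "\<bar>V * M - 1/81 * (1/9)\<bar> \<le> 0.0003"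
    by (rule near_mult, rule V, rule mM, simp)
  have gL: "\<bar>g' * L - 5/9 * (41/81)\<bar> \<le> 0.001"
    by (rule near_mult, rule g, rule L, simp)
  have McL: "\<bar>M * L - 1/9 * (41/81)\<bar> \<le> 0.0003"
    by (rule near_mult, rule mM, rule L, simp)
  have MW: "\<bar>M * W' - 1/9 * (5/9)\<bar> \<le> 0.0003"
    by (rule near_mult, rule mM, rule W, simp)
  have "\<bar>(Z + (1 - 2 * m)) - 4/3\<bar> \<le> 0.0008" using Z(1) f(2) unfolding abs_le_iff by (simp add: field_simps)
  then have VZ: "\<bar>V * (Z + (1 - 2 * m)) - 1/81 * (4/3)\<bar> \<le> 0.0017"
    by (rule near_mult[OF V], simp)
  have "\<bar>(g - (1 - 2 * m)) - (-2/9)\<bar> \<le> 0.0008" using g(1) f(2) unfolding abs_le_iff by (simp add: field_simps)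
  then have Vg: "\<bar>V * (g - (1 - 2 * m)) - 1/81 * (-2/9)\<bar> \<le> 0.0005"
    by (rule near_mult[OF V], simp)
  have mK: "\<bar>m * K' - 1/9 * (11/81)\<bar> \<le> 0.0002"
    by (rule near_mult, rule mM, rule K, simp)
  have cK: "\<bar>c * K' - 1/9 * (11/81)\<bar> \<le> 0.0002"
    by (rule near_mult, rule nears, rule K, simp)
  have WZ: "\<bar>W * Z - 5/9 * (5/9)\<bar> \<le> 0.001"
    by (rule near_mult, rule W, rule Z, simp)
  have fL: "\<bar>(1 - 2 * b2) * L - 7/9 * (41/81)\<bar> \<le> 0.001"
    by (rule near_mult, rule f, rule L, simp)
  text \<open>The fractions subtracted here are the partial derivatives of \<open>tilt_G\<close> at the point with all areas
    equal to \<open>1/9\<close>.\<close>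
  have D: "\<bar>Db - (-414/729)\<bar> \<le> 0.01" "\<bar>D2 - (-90/729)\<bar> \<le> 0.01" "\<bar>Dc - (-278/729)\<bar> \<le> 0.01"
      "\<bar>Da2 - (-44/729)\<bar> \<le> 0.01" "\<bar>Da3 - (-450/729)\<bar> \<le> 0.01" "\<bar>Da6 - (-574/729)\<bar> \<le> 0.01"
    unfolding Db_def D2_def Dc_def Da2_def Da3_def Da6_def
    using ZL VM gL McL MW VZ Vg mK cK WZ fL unfolding abs_le_iff by (simp_all add: field_simps)
  text \<open>Each area deviates from its corner value by its own distance \<open>q\<close> to an end of
    \<open>[lo, lo + r]\<close> and by a common shift \<open>s\<close>, which the total area fixes as a signed mean of the
    \<open>q\<close>'s. Hence only the gradient minus its mean matters; all its entries have the sign belonging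
    to the corner, the smallest being about \<open>26/729\<close> in absolute value.\<close>
  define s where "s = lo - m"
  define qb1 where "qb1 = lo + r - b1"
  define qa1 where "qa1 = lo + r - a1"
  define qb2 where "qb2 = b2 - lo"
  define qc where "qc = lo + r - c"
  define qa2 where "qa2 = a2 - lo"
  define qa3 where "qa3 = lo + r - a3"
  define qa6 where "qa6 = lo + r - a6"
  define qa4 where "qa4 = a4 - lo"
  define qa5 where "qa5 = a5 - lo"
  define Q where "Q = qb1 + qa1 + qb2 + qc + qa2 + qa3 + qa6 + qa4 + qa5"
  have q: "0 \<le> qb1" "0 \<le> qa1" "0 \<le> qb2" "0 \<le> qc" "0 \<le> qa2" "0 \<le> qa3" "0 \<le> qa6" "0 \<le> qa4" "0 \<le> qa5"
    using box unfolding qb1_def qa1_def qb2_def qc_def qa2_def qa3_def qa6_def qa4_def qa5_def by auto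
  have shift: "9 * s = qb1 + qa1 + qc + qa3 + qa6 - qb2 - qa2 - qa4 - qa5"
    using total unfolding s_def m_def qb1_def qa1_def qb2_def qc_def qa2_def qa3_def qa6_def qa4_def qa5_def by (simp add: field_simps)
  have dev: "b1 - M = s - qb1" "a1 - M = s - qa1" "b2 - m = s + qb2" "c - M = s - qc" "a2 - m = s + qa2" "a3 - M = s - qa3" "a6 - M = s - qa6"
    unfolding s_def m_def M_def qb1_def qa1_def qb2_def qc_def qa2_def qa3_def qa6_def by (simp_all add: field_simps)
  have s: "\<bar>s\<bar> \<le> Q / 9" using shift q unfolding Q_def abs_le_iff by simp
  have weigh: "d * (s + u) - 0.01 * (q + Q / 9) \<le> D * (s + u)"
    if "\<bar>D - d\<bar> \<le> 0.01" "\<bar>u\<bar> \<le> q" for D d u q :: real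
  proof -
    have "\<bar>(D - d) * (s + u)\<bar> \<le> 0.01 * (q + Q / 9)"
      unfolding abs_mult using that s by (intro mult_mono) auto
    then show ?thesis unfolding left_diff_distrib by linarith
  qed
  have weigh_hi: "d * (s - q) - 0.01 * (q + Q / 9) \<le> D * (s - q)"
    if "\<bar>D - d\<bar> \<le> 0.01" "0 \<le> q" for D d q :: real
    using weigh[OF that(1), of "- q" q] that(2) by simp
  have weigh_lo: "d * (s + q) - 0.01 * (q + Q / 9) \<le> D * (s + q)"
    if "\<bar>D - d\<bar> \<le> 0.01" "0 \<le> q" for D d q :: real
    using weigh[OF that(1), of q q] that(2) by simp
  \<comment> \<open>Once \<open>shift\<close> eliminates \<open>s\<close>, the gradient part gives
    each \<open>q\<close> a coefficient of at least about \<open>26/729 > 0.035\<close>, while the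
    errors take at most \<open>0.01 * (1 + 7/9) < 0.018\<close>.\<close>
  have "0 \<le> (-414/729 * (s - qb1) - 0.01 * (qb1 + Q / 9))
      + (-414/729 * (s - qa1) - 0.01 * (qa1 + Q / 9))
      + (-90/729 * (s + qb2) - 0.01 * (qb2 + Q / 9))
      + (-278/729 * (s - qc) - 0.01 * (qc + Q / 9))
      + (-44/729 * (s + qa2) - 0.01 * (qa2 + Q / 9))
      + (-450/729 * (s - qa3) - 0.01 * (qa3 + Q / 9))
      + (-574/729 * (s - qa6) - 0.01 * (qa6 + Q / 9))"
    using shift q unfolding Q_def by (simp add: field_simps)
  also have "\<dots> \<le> tilt_G b1 b2 c a1 a2 a3 a6 - tilt_G M m M M m M M"
    unfolding diff dev by (intro add_mono weigh_hi[OF D(1) q(1)] weigh_hi[OF D(1) q(2)] weigh_lo[OF D(2) q(3)] weigh_hi[OF D(3) q(4)]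
      weigh_lo[OF D(4) q(5)] weigh_hi[OF D(5) q(6)] weigh_hi[OF D(6) q(7)])
  finally have "0 \<le> tilt_G b1 b2 c a1 a2 a3 a6 - tilt_G M m M M m M M" .
  then show ?thesis using tilt_G_corner[of r] unfolding m_def M_def by simp
qed

section \<open>The minimal area range\<close>

lemma area_range_strip_triangles:
  assumes "strip_params e f k x1 x2 s1 s2"
  shows "area_range (set (strip_triangles e f k x1 x2 s1 s2)) =
    Max (set (strip_areas e f k x1 x2 s1 s2)) - Min (set (strip_areas e f k x1 x2 s1 s2))"
  unfolding area_range_def map_area_strip_triangles[OF assms, symmetric] by simp

text \<open>Provides the lower bound that the real infimum in \<open>Delta\<close> needs;
  \<open>0 < n\<close> rules out the empty family.\<close>

lemma area_range_nonneg:
  assumes "dissection n D" "0 < n"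
  shows "0 \<le> area_range D"
proof -
  have fin: "finite (area ` D)" and "D \<noteq> {}" using assms by (auto simp: dissection_def)
  then obtain a where "a \<in> area ` D" by blast
  then have "Min (area ` D) \<le> a" "a \<le> Max (area ` D)" using fin by simp_all
  then show ?thesis unfolding area_range_def by linarith
qed

lemma Delta_le_area_range:
  assumes "dissection n D" "0 < n"
  shows "Delta n \<le> area_range D"
  unfolding Delta_def using assms area_range_nonneg
  by (intro cINF_lower bdd_belowI2[where m = 0]) auto

lemma dissection_if_tilted_strip: "tilted_strip D \<Longrightarrow> dissection 9 D"
  unfolding tilted_strip_def by (rule conjunct1)

section \<open>The root of the quartic\<close>

lemma tilt_poly_strict_antimono:
  assumes "0 \<le> r" "r < s" "s \<le> 1 / 2"
  shows "tilt_poly s < tilt_poly r"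
proof -
  \<comment> \<open>The difference of the two values factors through \<open>s - r\<close>. In the
    cofactor the quartic term contributes at most 4864, which the linear coefficient 7850
    outweighs.\<close>
  have "r\<^sup>2 \<le> (1 / 2)\<^sup>2" "s\<^sup>2 \<le> (1 / 2)\<^sup>2" using assms by (intro power_mono; simp)+
  then have "(r + s) * (r\<^sup>2 + s\<^sup>2) \<le> 1 * 1"
    using assms by (intro mult_mono) (auto simp: power2_eq_square)
  then have "4864 * ((r + s) * (r\<^sup>2 + s\<^sup>2)) \<le> 4864" by simp
  moreover have "0 \<le> 824 * (r\<^sup>2 + r * s + s\<^sup>2) + 18804 * (r + s)" using assms by simp
  ultimately have "4864 * ((r + s) * (r\<^sup>2 + s\<^sup>2)) < 824 * (r\<^sup>2 + r * s + s\<^sup>2) + 18804 * (r + s) + 7850"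
    by simp
  then have "0 < (s - r) * (824 * (r\<^sup>2 + r * s + s\<^sup>2) + 18804 * (r + s) + 7850
      - 4864 * ((r + s) * (r\<^sup>2 + s\<^sup>2)))"
    using assms by (intro mult_pos_pos) auto
  also have "\<dots> = tilt_poly r - tilt_poly s"
    unfolding tilt_poly_def by algebra
  finally show ?thesis by simp
qed

lemma tilt_poly_root_enclosure:
  "\<exists>r. 0.000127349686128355334123703774 \<le> r \<and> r < 0.000127349686128355334123703775 \<and>
     tilt_poly r = 0"
proof -
  let ?a = "0.000127349686128355334123703774 :: real"
    and ?b = "0.000127349686128355334123703775 :: real"
  have neg: "tilt_poly ?b < 0" by (simp add: tilt_poly_def field_simps)
  have "\<exists>r. ?a \<le> r \<and> r \<le> ?b \<and> tilt_poly r = 0"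
  proof (rule IVT2')
    show "continuous_on {?a..?b} tilt_poly"
      unfolding tilt_poly_def[abs_def] by (intro continuous_intros)
    show "0 \<le> tilt_poly ?a" by (simp add: tilt_poly_def field_simps)
  qed (use neg in simp_all)
  then obtain r where r: "?a \<le> r" "r \<le> ?b" "tilt_poly r = 0" by blast
  \<comment> \<open>The polynomial is strictly negative at the right end, which makes that bound
    strict.\<close>
  moreover have "r \<noteq> ?b" using neg r(3) by (metis less_irrefl)
  ultimately show ?thesis by force
qed

lemma tilt_poly_root_unique:
  "\<exists>!r. r \<in> {0.000127<..<0.000128} \<and> tilt_poly r = 0"
proof -
  obtain r where "0.000127349686128355334123703774 \<le> r" "r < 0.000127349686128355334123703775"
      "tilt_poly r = 0"
    using tilt_poly_root_enclosure by blast
  moreover have "s = r" if "s \<in> {0.000127<..<0.000128}" "r \<in> {0.000127<..<0.000128}"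
      "tilt_poly s = 0" "tilt_poly r = 0" for r s
    using that tilt_poly_strict_antimono[of r s] tilt_poly_strict_antimono[of s r]
    by (cases r s rule: linorder_cases) auto
  ultimately show ?thesis by (intro ex1I[of _ r]) auto
qed

lemma r_tilt:
  "0.000127349686128355334123703774 \<le> r_tilt" "r_tilt < 0.000127349686128355334123703775"
  "tilt_poly r_tilt = 0"
proof -
  obtain r where r: "0.000127349686128355334123703774 \<le> r" "r < 0.000127349686128355334123703775"
      "tilt_poly r = 0"
    using tilt_poly_root_enclosure by blast
  then have "r_tilt = r"
    unfolding r_tilt_def by (intro the1_equality tilt_poly_root_unique) auto
  then show "0.000127349686128355334123703774 \<le> r_tilt" "r_tilt < 0.000127349686128355334123703775"
      "tilt_poly r_tilt = 0"
    using r by simp_all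
qed

text \<open>A smaller range would make the corner value positive, although \<open>tilt_G\<close>
  vanishes at the areas of every tilted strip.\<close>

lemma r_tilt_le_area_range:
  assumes "tilted_strip D"
  shows "r_tilt \<le> area_range D"
proof (rule ccontr)
  assume less: "\<not> r_tilt \<le> area_range D"
  obtain e f k x1 x2 s1 s2 where par: "strip_params e f k x1 x2 s1 s2"
    and D: "D = set (strip_triangles e f k x1 x2 s1 s2)"
    using assms unfolding tilted_strip_iff by blast
  define A where "A = set (strip_areas e f k x1 x2 s1 s2)"
  define r where "r = area_range D"
  have r: "r = Max A - Min A"
    unfolding r_def D A_def by (rule area_range_strip_triangles[OF par])
  have "finite A" unfolding A_def by simp
  then have box: "a \<in> {Min A..Min A + r}" if "a \<in> A" for a using that unfolding r by simp
  have "tilt_poly r / 6561 \<le> tilt_G ((1 - e) / 2) ((1 - f) / 2) (f * k / 2) (x1 / 2)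
     (s1 * (f - k * (f - e) - x1 * k) / 2) ((x2 - x1) * (1 - s1 * k) / 2) ((e - x2) * (1 - k) / 2)"
  proof (rule tilt_G_ge_corner[where lo = "Min A"])
    show "r \<le> 0.000128" using less r_tilt(2) unfolding r_def by simp
    show "(1 - e) / 2 + (1 - f) / 2 + f * k / 2 + x1 / 2 + s1 * (f - k * (f - e) - x1 * k) / 2
        + (x2 - x1) * (1 - s1 * k) / 2 + (s2 - s1) * (f - k * (f - e) - x2 * k) / 2
        + (1 - s2) * (f - k * (f - e) - x2 * k) / 2 + (e - x2) * (1 - k) / 2 = 1"
      by (simp add: field_simps)
  qed (rule box; simp add: A_def strip_areas_def Let_def)+
  then have "tilt_poly r \<le> 0" unfolding tilt_G_areas by simp
  moreover have "0 < tilt_poly r"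
    using tilt_poly_strict_antimono[of r r_tilt] less r_tilt
      area_range_nonneg[OF dissection_if_tilted_strip[OF assms]]
    unfolding r_def by simp
  ultimately show False by simp
qed

text \<open>Prescribing all areas but \<open>a\<^sub>3\<close>, \<open>a\<^sub>4\<close>, \<open>a\<^sub>5\<close> and requiring \<open>a\<^sub>4 = a\<^sub>5\<close> determines the
  configuration. Then \<open>a\<^sub>3\<close> comes out right because \<open>r_tilt\<close> is a root, and \<open>a\<^sub>4\<close>, \<open>a\<^sub>5\<close> by the
  total area.\<close>

lemma ex_strip_areas_r_tilt:
  defines "m \<equiv> (1 - 5 * r_tilt) / 9" and "M \<equiv> (1 + 4 * r_tilt) / 9"
  shows "\<exists>e f k x1 x2 s1 s2. strip_params e f k x1 x2 s1 s2 \<and>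
    strip_areas e f k x1 x2 s1 s2 = [M, m, M, M, m, M, m, m, M]"
proof -
  have bnd: "0.111 < m" "m < 0.112" "0.111 < M" "M < 0.112" and mM: "m < M" "M - m < 0.001"
    using r_tilt(1,2) unfolding m_def M_def by (simp_all add: field_simps)
  \<comment> \<open>The witnesses solve in turn \<open>b1 = M\<close>, \<open>b2 = m\<close>,
    \<open>c = M\<close>, \<open>a2 = m\<close> and \<open>a6 = M\<close>, with
    \<open>x1 = 2 * M\<close> from \<open>a1 = M\<close>. The midpoint \<open>s2\<close> makes
    \<open>a4 = a5\<close>.\<close>
  define e f where "e = 1 - 2 * M" and "f = 1 - 2 * m"
  define k where "k = 2 * M / f"
  define h where "h = f - k * (f - e) - 2 * M * k"
  define s1 where "s1 = 2 * m / h"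
  define x2 where "x2 = e - 2 * M / (1 - k)"
  define s2 where "s2 = (1 + s1) / 2"
  have f: "0.776 < f" "f < 0.778" and e: "0.776 < e" "e < 0.778"
    using bnd by (simp_all add: e_def f_def)
  have k: "0.28 < k" "k < 0.29"
    using f bnd by (simp_all add: k_def field_simps)
  have "k * (f - e) \<le> 1 * 0.002" "2 * M * k \<le> 0.224 * 0.29"
    using k bnd mM by (intro mult_mono; simp add: e_def f_def)+
  then have h: "0.7 < h" unfolding h_def using f by simp
  have s1: "0 < s1" "s1 < 0.33" using h bnd by (simp_all add: s1_def field_simps)
  have "0.3 < 2 * M / (1 - k)" "2 * M / (1 - k) < 0.33"
    using k bnd by (simp_all add: field_simps)
  then have x2: "0.44 < x2" "x2 < e" using e by (simp_all add: x2_def)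
  have par: "strip_params e f k (2 * M) x2 s1 s2"
    unfolding strip_params_def s2_def using e f k bnd x2 s1 by simp
  define a3 where "a3 = (x2 - 2 * M) * (1 - s1 * k) / 2"
  have "f \<noteq> 2 * M" using f bnd by simp
  then have areas: "(1 - e) / 2 = M" "(1 - f) / 2 = m" "f * k / 2 = M" "2 * M / 2 = M"
      "s1 * (f - k * (f - e) - 2 * M * k) / 2 = m" "(e - x2) * (1 - k) / 2 = M"
    using f k h \<open>f \<noteq> 2 * M\<close> unfolding h_def[symmetric]
    by (simp_all add: e_def k_def s1_def x2_def flip: f_def) (simp add: f_def)
  \<comment> \<open>Both sides vanish, the left by the area relation and the right at the root. As
    \<open>tilt_G\<close> is affine in \<open>a3\<close> with slope \<open>- 2 * w * z\<close>,
    which is nonzero here, \<open>a3 = M\<close> follows.\<close>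
  have "tilt_G M m M M m a3 M = tilt_G M m M M m M M"
    using tilt_G_areas[of e f k "2 * M" s1 x2] tilt_G_corner[of r_tilt] r_tilt(3)
    unfolding areas a3_def m_def[symmetric] M_def[symmetric] by simp
  then have "(a3 - M) * ((f * (f - 2 * M) + 2 * M * (e - 2 * M)) * (f - 2 * M)) = 0"
    unfolding tilt_G_def Let_def e_def f_def by algebra
  moreover have "0 < (f * (f - 2 * M) + 2 * M * (e - 2 * M)) * (f - 2 * M)"
    using f e bnd by (intro mult_pos_pos add_pos_pos) simp_all
  ultimately have a3: "a3 = M" by (metis eq_iff_diff_eq_0 less_irrefl mult_eq_0_iff)
  have s2: "s2 - s1 = (1 - s1) / 2" "1 - s2 = (1 - s1) / 2" by (simp_all add: s2_def field_simps)
  define a where "a = (1 - s1) / 2 * (f - k * (f - e) - x2 * k) / 2"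
  have eq: "strip_areas e f k (2 * M) x2 s1 s2 = [M, m, M, M, m, M, a, a, M]"
    unfolding strip_areas_def Let_def areas s2 a3[unfolded a3_def] a_def[symmetric] ..
  have "a = m"
    using sum_list_strip_areas[of e f k "2 * M" x2 s1 s2] unfolding eq by (simp add: m_def M_def field_simps)
  then show ?thesis using par eq by blast
qed

lemma ex_tilted_strip_area_range_r_tilt: "\<exists>D. tilted_strip D \<and> area_range D = r_tilt"
proof -
  define m where "m = (1 - 5 * r_tilt) / 9"
  define M where "M = (1 + 4 * r_tilt) / 9"
  obtain e f k x1 x2 s1 s2 where par: "strip_params e f k x1 x2 s1 s2"
    and areas: "strip_areas e f k x1 x2 s1 s2 = [M, m, M, M, m, M, m, m, M]"
    using ex_strip_areas_r_tilt unfolding m_def M_def by blast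
  have "M - m = r_tilt" by (simp add: m_def M_def field_simps)
  then have "area_range (set (strip_triangles e f k x1 x2 s1 s2)) = r_tilt"
    unfolding area_range_strip_triangles[OF par] areas using r_tilt(1) by (simp add: max_def min_def)
  then show ?thesis using par unfolding tilted_strip_iff by blast
qed

theorem proposition3:
  shows "(\<exists>!r. r \<in> {0.000127<..<0.000128} \<and> tilt_poly r = 0) \<and>
         Delta 9 \<le> r_tilt \<and>
         0.000127349686128355334123703774 \<le> r_tilt \<and>
         r_tilt < 0.000127349686128355334123703775 \<and>
         (\<exists>D. tilted_strip D \<and> area_range D = r_tilt) \<and>
         (\<forall>D. tilted_strip D \<longrightarrow> r_tilt \<le> area_range D)"
proof (intro conjI tilt_poly_root_unique r_tilt(1,2) ex_tilted_strip_area_range_r_tilt)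
  obtain D where "tilted_strip D" "area_range D = r_tilt"
    using ex_tilted_strip_area_range_r_tilt by blast
  then show "Delta 9 \<le> r_tilt"
    using Delta_le_area_range[OF dissection_if_tilted_strip, of D] by simp
qed (simp add: r_tilt_le_area_range)

end
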